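(* Consider the problem $\min_{x\in\mathbb{R}^n}F(x)$ with $F=(F_1,\dots,F_m)$, $F_i=f_i+g_i$, where each $f_i$ is continuously differentiable and $L_i$-smooth and each $g_i$ is proper, convex and lower semicontinuous. Assume that $f_i$ is strongly convex with modulus $\mu_i>0$ for every $i\in[m]$. Let $\{x^k\}$ be the (infinite) sequence generated from $x^0\in\mathbb{R}^n$ by $$x^{k+1}=\mathop{\arg\min}_{x\in\mathbb{R}^n}\max_{i\in[m]}\left\{\frac{\langle\nabla f_i(x^k),x-x^k\rangle+g_i(x)-g_i(x^k)}{L_i}+\frac12\|x-x^k\|^2\right\},\qquad k=0,1,2,\dots$$ Then: (i) $\{x^k\}$ converges to some Pareto solution $x^*$. (ii) For all $k\ge0$, $$\|x^{k+1}-x^*\|\le\sqrt{1-\min_{i\in[m]}\left\{\frac{\mu_i}{L_i}\right\}}\;\|x^k-x^*\|.$$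
   Context: Notation: $[m]=\{1,\dots,m\}$; for $u,v\in\mathbb{R}^m$, $u\preceq v$ means $u_i\le v_i$ for all $i$. $F:\mathbb{R}^n\to\mathbb{R}^m$. A point $x^*$ is a Pareto solution if there is no $x$ with $F(x)\preceq F(x^* )$ and $F(x)\ne F(x^* )$. It is Pareto critical if $\max_{i\in[m]}F_i'(x^*;d)\ge0$ for all $d\in\mathbb{R}^n$, where $F_i'(x;d)$ is the directional derivative. A differentiable $h$ is $L$-smooth if $\|\nabla h(y)-\nabla h(x)\|\le L\|y-x\|$ for all $x,y$, and $\mu$-strongly convex if $\langle\nabla h(y)-\nabla h(x),y-x\rangle\ge\mu\|y-x\|^2$ for all $x,y$. The algorithm stops if $x^{k+1}=x^k$; standing assumption: it does not stop, i.e. it produces an infinite sequence of points that are not Pareto critical. *)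

theory Defs
  imports "HOL-Analysis.Analysis"
begin

definition grad :: "(real^'n \<Rightarrow> real) \<Rightarrow> real^'n \<Rightarrow> real^'n" where
  "grad h x = (THE D. GDERIV h x :> D)"

definition continuously_differentiable :: "(real^'n \<Rightarrow> real) \<Rightarrow> bool" where
  "continuously_differentiable h \<longleftrightarrow>
     (\<forall>x. h differentiable (at x)) \<and> continuous_on UNIV (grad h)"

definition L_smooth :: "real \<Rightarrow> (real^'n \<Rightarrow> real) \<Rightarrow> bool" where
  "L_smooth L h \<longleftrightarrow>
     (\<forall>x. h differentiable (at x)) \<and>
     (\<forall>x y. norm (grad h y - grad h x) \<le> L * norm (y - x))"

definition strongly_convex :: "real \<Rightarrow> (real^'n \<Rightarrow> real) \<Rightarrow> bool" where
  "strongly_convex \<mu> h \<longleftrightarrow>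
     (\<forall>x. h differentiable (at x)) \<and>
     (\<forall>x y. inner (grad h y - grad h x) (y - x) \<ge> \<mu> * (norm (y - x))\<^sup>2)"

text \<open>The nonsmooth parts may take the value \<open>\<infinity>\<close>, as usual for proper convex functions;
  real-valued functions are the special case \<open>\<lambda>x. ereal (g x)\<close>.\<close>

definition proper_fun :: "(real^'n \<Rightarrow> ereal) \<Rightarrow> bool" where
  "proper_fun g \<longleftrightarrow> (\<forall>x. g x \<noteq> -\<infinity>) \<and> (\<exists>x. g x \<noteq> \<infinity>)"

text \<open>Convexity through the epigraph avoids products such as \<open>0 * \<infinity>\<close>.\<close>

definition convex_fun :: "(real^'n \<Rightarrow> ereal) \<Rightarrow> bool" where
  "convex_fun g \<longleftrightarrow> convex {(x, r :: real). g x \<le> ereal r}"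

definition lsc_fun :: "(real^'n \<Rightarrow> ereal) \<Rightarrow> bool" where
  "lsc_fun g \<longleftrightarrow> (\<forall>x. g x \<le> Liminf (at x) g)"

text \<open>Vectors of objective values are functions on the finite index type \<open>'m\<close>, so that the
  componentwise order is the pointwise order \<open>\<le>\<close> on functions.\<close>

definition composite ::
  "('m \<Rightarrow> real^'n \<Rightarrow> real) \<Rightarrow> ('m \<Rightarrow> real^'n \<Rightarrow> ereal) \<Rightarrow> real^'n \<Rightarrow> 'm \<Rightarrow> ereal" where
  "composite f g = (\<lambda>x i. ereal (f i x) + g i x)"

text \<open>A Pareto solution has finite objective values; for real-valued \<open>F\<close> this is automatic.\<close>

definition pareto_solution :: "(real^'n \<Rightarrow> 'm \<Rightarrow> ereal) \<Rightarrow> real^'n \<Rightarrow> bool" where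
  "pareto_solution F x \<longleftrightarrow>
     (\<forall>i. \<bar>F x i\<bar> \<noteq> \<infinity>) \<and> \<not> (\<exists>y. F y \<le> F x \<and> F y \<noteq> F x)"

definition dir_deriv :: "(real^'n \<Rightarrow> ereal) \<Rightarrow> real^'n \<Rightarrow> real^'n \<Rightarrow> ereal" where
  "dir_deriv h x d = Lim (at_right (0::real)) (\<lambda>t. (h (x + t *\<^sub>R d) - h x) / ereal t)"

definition pareto_critical :: "(real^'n \<Rightarrow> 'm::finite \<Rightarrow> ereal) \<Rightarrow> real^'n \<Rightarrow> bool" where
  "pareto_critical F x \<longleftrightarrow> (\<forall>d. (MAX i. dir_deriv (\<lambda>y. F y i) x d) \<ge> 0)"

definition subproblem_obj ::
  "('m::finite \<Rightarrow> real^'n \<Rightarrow> real) \<Rightarrow> ('m \<Rightarrow> real^'n \<Rightarrow> ereal) \<Rightarrow> ('m \<Rightarrow> real)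
     \<Rightarrow> real^'n \<Rightarrow> real^'n \<Rightarrow> ereal" where
  "subproblem_obj f g L xk z =
     (MAX i. (ereal (inner (grad (f i) xk) (z - xk)) + g i z - g i xk) / ereal (L i)
               + ereal (1/2 * (norm (z - xk))\<^sup>2))"

end

theory Submission
  imports Defs
begin

text \<open>The model \<open>\<phi>\<^sub>k\<close> minimised in step \<open>k\<close> is 1-strongly convex, so
  \<open>\<phi>\<^sub>k(z) \<ge> \<phi>\<^sub>k(x\<^sup>k\<^sup>+\<^sup>1) + \<parallel>z - x\<^sup>k\<^sup>+\<^sup>1\<parallel>\<^sup>2/2\<close> for all \<open>z\<close>. Bounding the left side by strong convexity of
  the \<open>f\<^sub>i\<close> and the right side by the descent lemma shows that every \<open>z\<close> with \<open>F(z) \<le> F(x\<^sup>k\<^sup>+\<^sup>1)\<close>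
  satisfies \<open>\<parallel>z - x\<^sup>k\<^sup>+\<^sup>1\<parallel> \<le> q \<parallel>z - x\<^sup>k\<parallel>\<close> with \<open>q\<^sup>2 = 1 - min\<^sub>i \<mu>\<^sub>i/L\<^sub>i < 1\<close>. As \<open>F\<close> decreases along the
  sequence, \<open>z = x\<^sup>j\<close> is allowed for all \<open>j > k\<close>, which makes the sequence Cauchy; its limit is
  allowed by lower semicontinuity, which gives the rate; and any point that dominates the limit is
  allowed too, hence is itself a limit of the sequence, so the limit is a Pareto solution.\<close>

section \<open>Gradients and the quadratic bounds from smoothness and strong convexity\<close>

lemma GDERIV_grad:
  fixes h :: "real^'n \<Rightarrow> real"
  assumes "h differentiable (at x)"
  shows "GDERIV h x :> grad h x"
proof -
  obtain h' where h': "(h has_derivative h') (at x)"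
    using assms unfolding differentiable_def by blast
  interpret bounded_linear h' using h' by (rule has_derivative_bounded_linear)
  have "h' = (\<lambda>v. v \<bullet> adjoint h' 1)"
    using adjoint_works[OF linear_axioms] by (auto simp: fun_eq_iff)
  with h' have D: "GDERIV h x :> adjoint h' 1" by (simp add: gderiv_def)
  moreover have "D = adjoint h' 1" if "GDERIV h x :> D" for D
  proof -
    have "(\<lambda>v. v \<bullet> D) = (\<lambda>v. v \<bullet> adjoint h' 1)"
      using has_derivative_unique that D unfolding gderiv_def by blast
    then show ?thesis by (metis vector_eq_ldot)
  qed
  ultimately show ?thesis unfolding grad_def by (rule theI)
qed

text \<open>Along the segment from \<open>x\<close> to \<open>y\<close>, the gap \<psi> between
  \<open>h\<close> and its quadratic model is nonincreasing on [0,1]. The constant \<open>c\<close>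
  may have any sign, so the bound also serves strong convexity.\<close>

lemma quadratic_upper_bound:
  fixes h :: "'a::real_inner \<Rightarrow> real"
  assumes G: "\<And>z. GDERIV h z :> G z"
    and le: "\<And>y. (G y - G x) \<bullet> (y - x) \<le> c * (norm (y - x))\<^sup>2"
  shows "h y \<le> h x + G x \<bullet> (y - x) + c / 2 * (norm (y - x))\<^sup>2"
proof -
  define \<psi> where
    "\<psi> t = h (x + t *\<^sub>R (y - x)) - t * (G x \<bullet> (y - x)) - c / 2 * t\<^sup>2 * (norm (y - x))\<^sup>2" for t
  define \<psi>' where
    "\<psi>' t = (G (x + t *\<^sub>R (y - x)) - G x) \<bullet> (y - x) - c * t * (norm (y - x))\<^sup>2" for t
  have D: "(\<psi> has_real_derivative \<psi>' t) (at t)" for t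
  proof -
    have "((\<lambda>t. x + t *\<^sub>R (y - x)) has_derivative (\<lambda>s. s *\<^sub>R (y - x))) (at t)"
      by (auto intro!: derivative_eq_intros)
    from has_derivative_compose[OF this G[unfolded gderiv_def]]
    have "((\<lambda>t. h (x + t *\<^sub>R (y - x))) has_derivative
        (\<lambda>s. (s *\<^sub>R (y - x)) \<bullet> G (x + t *\<^sub>R (y - x)))) (at t)" .
    then have "((\<lambda>t. h (x + t *\<^sub>R (y - x))) has_real_derivative
        (G (x + t *\<^sub>R (y - x)) \<bullet> (y - x))) (at t)"
      by (simp add: has_field_derivative_def inner_commute mult_commute_abs)
    then show ?thesis unfolding \<psi>_def \<psi>'_def
      by (auto intro!: derivative_eq_intros simp: inner_diff_left)
  qed
  have nonpos: "\<psi>' t \<le> 0" if "0 \<le> t" for t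
  proof (cases "t = 0")
    case False
    \<comment> \<open>At \<open>x + t *\<^sub>R (y - x)\<close> the hypothesis carries a factor t on
      the left and t^2 on the right; one t cancels when t > 0.\<close>
    have "t * ((G (x + t *\<^sub>R (y - x)) - G x) \<bullet> (y - x)) \<le> t * (c * t * (norm (y - x))\<^sup>2)"
      using le[of "x + t *\<^sub>R (y - x)"] by (simp add: power_mult_distrib power2_eq_square ac_simps)
    then show ?thesis using that False unfolding \<psi>'_def by simp
  qed (simp add: \<psi>'_def)
  have "\<psi> 1 \<le> \<psi> 0"
    by (rule DERIV_nonpos_imp_nonincreasing) (use D nonpos in auto)
  then show ?thesis by (simp add: \<psi>_def)
qed

text \<open>This is the upper bound applied to \<open>-h\<close> with the constant
  \<open>-c\<close>.\<close>

lemma quadratic_lower_bound: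
  fixes h :: "'a::real_inner \<Rightarrow> real"
  assumes G: "\<And>z. GDERIV h z :> G z"
    and ge: "\<And>y. (G y - G x) \<bullet> (y - x) \<ge> c * (norm (y - x))\<^sup>2"
  shows "h y \<ge> h x + G x \<bullet> (y - x) + c / 2 * (norm (y - x))\<^sup>2"
proof -
  have "(- G y - - G x) \<bullet> (y - x) \<le> - c * (norm (y - x))\<^sup>2" for y
    using ge[of y] by (simp add: inner_diff_left)
  from quadratic_upper_bound[OF GDERIV_minus[OF G] this, of y] show ?thesis by simp
qed

lemma L_smooth_upper_bound:
  assumes "L_smooth c h"
  shows "h y \<le> h x + grad h x \<bullet> (y - x) + c / 2 * (norm (y - x))\<^sup>2"
proof (rule quadratic_upper_bound)
  show "GDERIV h z :> grad h z" for z
    using assms by (intro GDERIV_grad) (simp add: L_smooth_def)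
  show "(grad h y - grad h x) \<bullet> (y - x) \<le> c * (norm (y - x))\<^sup>2" for y
  proof -
    have "(grad h y - grad h x) \<bullet> (y - x) \<le> norm (grad h y - grad h x) * norm (y - x)"
      by (rule norm_cauchy_schwarz)
    also have "\<dots> \<le> (c * norm (y - x)) * norm (y - x)"
      using assms by (intro mult_right_mono) (auto simp: L_smooth_def)
    finally show ?thesis by (simp add: power2_eq_square ac_simps)
  qed
qed

lemma strongly_convex_lower_bound:
  assumes "strongly_convex c h"
  shows "h y \<ge> h x + grad h x \<bullet> (y - x) + c / 2 * (norm (y - x))\<^sup>2"
  using assms by (intro quadratic_lower_bound GDERIV_grad) (auto simp: strongly_convex_def)

text \<open>At a unit vector the quadratic bounds based at 0 share their affine part, which leaves
  c/2 \<le> L/2. This yields both \<open>L i > 0\<close> and \<open>\<mu> i / L i \<le> 1\<close>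
  later.\<close>

lemma strongly_convex_le_L_smooth:
  fixes h :: "real^'n \<Rightarrow> real"
  assumes "L_smooth L h" "strongly_convex c h"
  shows "c \<le> L"
proof -
  obtain b :: "real^'n" where "b \<in> Basis" using nonempty_Basis by blast
  then have "norm b = 1" by simp
  with strongly_convex_lower_bound[OF assms(2), of 0 b] L_smooth_upper_bound[OF assms(1), of b 0]
  show ?thesis by simp
qed

section \<open>Growth of the model around its minimiser and the one-step estimates\<close>

lemma norm_convex_combination_sq:
  fixes p z :: "'a::real_inner"
  shows "(norm ((1 - t) *\<^sub>R p + t *\<^sub>R z))\<^sup>2 =
    (1 - t) * (norm p)\<^sup>2 + t * (norm z)\<^sup>2 - t * (1 - t) * (norm (z - p))\<^sup>2"
  unfolding power2_norm_eq_inner by (simp add: inner_simps inner_commute algebra_simps)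

text \<open>The half squared norm adds the same convexity gap t(1-t)/2 * \<open>N\<close> to every
  component, so the gap survives the maximum. Comparing \<open>p\<close> with points of the segment
  towards \<open>z\<close>, dividing by t and letting t tend to 0 gives the growth.\<close>

lemma prox_max_growth:
  fixes h :: "'i::finite \<Rightarrow> 'a::real_inner \<Rightarrow> real" and a :: 'a
  defines "\<phi> z \<equiv> MAX i. h i z + 1/2 * (norm (z - a))\<^sup>2"
  assumes conv: "\<And>i. convex_on D (h i)" and "p \<in> D" "z \<in> D"
    and min: "\<And>y. y \<in> D \<Longrightarrow> \<phi> p \<le> \<phi> y"
  shows "\<phi> p + 1/2 * (norm (z - p))\<^sup>2 \<le> \<phi> z"
proof -
  define N where "N = (norm (z - p))\<^sup>2"
  have i_le: "h i y + 1/2 * (norm (y - a))\<^sup>2 \<le> \<phi> y" for i y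
    unfolding \<phi>_def by (intro Max_ge) auto
  have bound: "(1 - t) / 2 * N \<le> \<phi> z - \<phi> p" if t: "0 < t" "t < 1" for t
  proof -
    define y where "y = (1 - t) *\<^sub>R p + t *\<^sub>R z"
    have "D \<noteq> {} \<and> convex D" using conv \<open>p \<in> D\<close> by (auto simp: convex_on_def)
    then have "y \<in> D" unfolding y_def
      using t \<open>p \<in> D\<close> \<open>z \<in> D\<close> by (intro convexD) auto
    have "h i y + 1/2 * (norm (y - a))\<^sup>2 \<le> (1 - t) * \<phi> p + t * \<phi> z - t * (1 - t) / 2 * N" for i
    proof -
      have "h i y \<le> (1 - t) * h i p + t * h i z"
        unfolding y_def using t \<open>p \<in> D\<close> \<open>z \<in> D\<close> by (intro convex_onD[OF conv]) auto
      moreover have "y - a = (1 - t) *\<^sub>R (p - a) + t *\<^sub>R (z - a)"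
        unfolding y_def by (simp add: algebra_simps)
      then have "(norm (y - a))\<^sup>2 =
          (1 - t) * (norm (p - a))\<^sup>2 + t * (norm (z - a))\<^sup>2 - t * (1 - t) * N"
        using norm_convex_combination_sq[of t "p - a" "z - a"] by (simp add: N_def)
      moreover have "(1 - t) * (h i p + 1/2 * (norm (p - a))\<^sup>2) \<le> (1 - t) * \<phi> p"
        "t * (h i z + 1/2 * (norm (z - a))\<^sup>2) \<le> t * \<phi> z"
        using t by (intro mult_left_mono i_le; simp)+
      ultimately show ?thesis by (simp add: algebra_simps add_divide_distrib diff_divide_distrib)
    qed
    then have "\<phi> y \<le> (1 - t) * \<phi> p + t * \<phi> z - t * (1 - t) / 2 * N"
      unfolding \<phi>_def[of y] by (intro Max.boundedI) auto
    with min[OF \<open>y \<in> D\<close>] have "t * ((1 - t) / 2 * N) \<le> t * (\<phi> z - \<phi> p)"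
      by (simp add: algebra_simps)
    then show ?thesis using t by simp
  qed
  have "((\<lambda>t. (1 - t) / 2 * N) \<longlongrightarrow> (1 - 0) / 2 * N) (at_right 0)"
    by (intro tendsto_intros) auto
  moreover have "\<forall>\<^sub>F t in at_right 0. (1 - t) / 2 * N \<le> \<phi> z - \<phi> p"
    unfolding eventually_at_right_field using bound by (intro exI[of _ 1]) auto
  ultimately have "(1 - 0) / 2 * N \<le> \<phi> z - \<phi> p"
    by (rule tendsto_upperbound) simp
  then show ?thesis by (simp add: N_def)
qed

lemma prox_step_contraction:
  fixes f :: "'m::finite \<Rightarrow> real^'n \<Rightarrow> real" and g :: "'m \<Rightarrow> real^'n \<Rightarrow> real"
    and L :: "'m \<Rightarrow> real"
  defines "\<phi> a z \<equiv> MAX i. (grad (f i) a \<bullet> (z - a) + g i z - g i a) / L i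
    + 1/2 * (norm (z - a))\<^sup>2"
  assumes smooth: "\<And>i. L_smooth (L i) (f i)" and strong: "\<And>i. strongly_convex (\<mu> i) (f i)"
    and L_pos: "\<And>i. 0 < L i" and conv: "\<And>i. convex_on D (g i)" and "p \<in> D"
    and min: "\<And>y. y \<in> D \<Longrightarrow> \<phi> a p \<le> \<phi> a y"
    and "z \<in> D" and below: "\<And>i. f i z + g i z \<le> f i p + g i p"
  shows "norm (p - z) \<le> sqrt (1 - (MIN i. \<mu> i / L i)) * norm (a - z)"
proof -
  define h where "h i z = (grad (f i) a \<bullet> (z - a) + g i z - g i a) / L i" for i z
  define \<kappa> where "\<kappa> = (MIN i. \<mu> i / L i)"
  \<comment> \<open>The largest scaled change of the objective from \<open>a\<close> links the two
    sides of the growth inequality: it bounds \<phi> at \<open>p\<close> from below and \<phi> at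
    \<open>z\<close> from above, and then cancels.\<close>
  define m where "m y = (MAX i. (f i y + g i y - (f i a + g i a)) / L i)" for y
  have \<phi>_eq: "\<phi> a y = (MAX i. h i y + 1/2 * (norm (y - a))\<^sup>2)" for y
    by (simp add: \<phi>_def h_def)
  have convD: "convex D" using conv by (auto simp: convex_on_def)
  have "convex_on D (h i)" for i
  proof (rule convex_onI)
    fix t x y assume t: "0 < t" "t < (1::real)" and xy: "x \<in> D" "y \<in> D"
    have "g i ((1 - t) *\<^sub>R x + t *\<^sub>R y) \<le> (1 - t) * g i x + t * g i y"
      using t xy by (intro convex_onD[OF conv]) auto
    then have "grad (f i) a \<bullet> ((1 - t) *\<^sub>R x + t *\<^sub>R y - a) + g i ((1 - t) *\<^sub>R x + t *\<^sub>R y) - g i a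
        \<le> (1 - t) * (grad (f i) a \<bullet> (x - a) + g i x - g i a)
          + t * (grad (f i) a \<bullet> (y - a) + g i y - g i a)"
      by (simp add: inner_simps algebra_simps)
    then show "h i ((1 - t) *\<^sub>R x + t *\<^sub>R y) \<le> (1 - t) * h i x + t * h i y"
      unfolding h_def using divide_right_mono[OF _ less_imp_le[OF L_pos[of i]]]
      by (fastforce simp: add_divide_distrib)
  qed (rule convD)
  from prox_max_growth[of D h p z a] this \<open>p \<in> D\<close> \<open>z \<in> D\<close> min
  have growth: "\<phi> a p + 1/2 * (norm (z - p))\<^sup>2 \<le> \<phi> a z"
    unfolding \<phi>_eq by blast
  have "m z \<le> \<phi> a p"
    unfolding m_def
  proof (intro Max.boundedI; clarsimp)
    fix i
    have "f i z + g i z - (f i a + g i a) \<le> f i p + g i p - (f i a + g i a)"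
      using below[of i] by simp
    also have "\<dots> \<le> grad (f i) a \<bullet> (p - a) + g i p - g i a + L i / 2 * (norm (p - a))\<^sup>2"
      using L_smooth_upper_bound[OF smooth[of i], of p a] by simp
    \<comment> \<open>Division by \<open>L i\<close> turns the descent term into exactly the 1/2 of
      the model.\<close>
    also have "\<dots> = L i * (h i p + 1/2 * (norm (p - a))\<^sup>2)"
      using L_pos[of i] by (simp add: h_def field_simps)
    also have "\<dots> \<le> L i * \<phi> a p"
      unfolding \<phi>_eq using L_pos[of i] by (intro mult_left_mono Max_ge) auto
    finally show "(f i z + g i z - (f i a + g i a)) / L i \<le> \<phi> a p"
      using L_pos[of i] by (simp add: divide_le_eq mult.commute)
  qed
  moreover have "\<phi> a z \<le> m z + (1 - \<kappa>) / 2 * (norm (z - a))\<^sup>2"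
    unfolding \<phi>_eq
  proof (intro Max.boundedI; clarsimp)
    fix i
    \<comment> \<open>The worst ratio gives a strong convexity gain that is uniform in i after
      scaling.\<close>
    have "\<kappa> \<le> \<mu> i / L i" unfolding \<kappa>_def by (intro Min_le) auto
    then have "L i * (\<kappa> / 2 * (norm (z - a))\<^sup>2) \<le> \<mu> i / 2 * (norm (z - a))\<^sup>2"
      using L_pos[of i] mult_right_mono[of "L i * \<kappa>" "\<mu> i" "(norm (z - a))\<^sup>2 / 2"]
      by (simp add: le_divide_eq mult.commute mult.left_commute)
    moreover have "L i * h i z = grad (f i) a \<bullet> (z - a) + g i z - g i a"
      using L_pos[of i] by (simp add: h_def)
    ultimately have "L i * h i z + L i * (\<kappa> / 2 * (norm (z - a))\<^sup>2)
        \<le> f i z + g i z - (f i a + g i a)"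
      using strongly_convex_lower_bound[OF strong[of i], of a z] by linarith
    then have "h i z + \<kappa> / 2 * (norm (z - a))\<^sup>2 \<le> (f i z + g i z - (f i a + g i a)) / L i"
      using L_pos[of i] by (simp add: le_divide_eq algebra_simps)
    also have "\<dots> \<le> m z" unfolding m_def by (intro Max_ge) auto
    finally show "h i z + (norm (z - a))\<^sup>2 / 2 \<le> m z + (1 - \<kappa>) * (norm (z - a))\<^sup>2 / 2"
      by (simp add: algebra_simps diff_divide_distrib)
  qed
  ultimately have "(norm (p - z))\<^sup>2 \<le> (1 - \<kappa>) * (norm (a - z))\<^sup>2"
    using growth by (simp add: norm_minus_commute)
  then have "norm (p - z) \<le> sqrt ((1 - \<kappa>) * (norm (a - z))\<^sup>2)"
    by (rule real_le_rsqrt)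
  then show ?thesis by (simp add: real_sqrt_mult \<kappa>_def)
qed

text \<open>The model vanishes at \<open>a\<close>, so its value at \<open>p\<close> is at most 0,
  and the descent lemma transfers this to each objective separately.\<close>

lemma prox_step_descent:
  fixes f :: "'m::finite \<Rightarrow> real^'n \<Rightarrow> real" and g :: "'m \<Rightarrow> real^'n \<Rightarrow> real"
    and L :: "'m \<Rightarrow> real"
  defines "\<phi> a z \<equiv> MAX i. (grad (f i) a \<bullet> (z - a) + g i z - g i a) / L i
    + 1/2 * (norm (z - a))\<^sup>2"
  assumes smooth: "\<And>i. L_smooth (L i) (f i)" and L_pos: "\<And>i. 0 < L i"
    and min: "\<phi> a p \<le> \<phi> a a"
  shows "f i p + g i p \<le> f i a + g i a"
proof -
  have "(grad (f i) a \<bullet> (p - a) + g i p - g i a) / L i + 1/2 * (norm (p - a))\<^sup>2 \<le> \<phi> a p"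
    unfolding \<phi>_def by (intro Max_ge) auto
  also have "\<dots> \<le> 0" using min by (simp add: \<phi>_def)
  finally have "grad (f i) a \<bullet> (p - a) + g i p - g i a + L i / 2 * (norm (p - a))\<^sup>2 \<le> 0"
    using L_pos[of i] by (simp add: field_simps)
  then show ?thesis using L_smooth_upper_bound[OF smooth[of i], of p a] by simp
qed

section \<open>Extended-valued convexity and lower semicontinuity\<close>

lemma convex_fun_le:
  assumes "convex_fun g" "g x \<le> ereal r" "g y \<le> ereal s" "0 \<le> u" "0 \<le> v" "u + v = 1"
  shows "g (u *\<^sub>R x + v *\<^sub>R y) \<le> ereal (u * r + v * s)"
  using convexD[OF assms(1)[unfolded convex_fun_def], of "(x, r)" "(y, s)" u v] assms(2-)
  by simp

text \<open>Sublevel sets of the sum are closed. Since \<open>g l\<close> might be infinite, the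
  limit is taken with an arbitrary real r < \<open>g l\<close> in place of \<open>g l\<close>;
  density of the reals then gives the bound.\<close>

lemma lsc_fun_add_le:
  assumes lsc: "lsc_fun g" and cont: "isCont f l"
    and lim: "X \<longlonglongrightarrow> l" and le: "\<forall>\<^sub>F n in sequentially. ereal (f (X n)) + g (X n) \<le> ereal c"
  shows "ereal (f l) + g l \<le> ereal c"
proof -
  have *: "f l + r \<le> c" if r: "ereal r < g l" for r
  proof -
    have "\<forall>\<^sub>F y in at l. ereal r < g y"
      using lsc r unfolding lsc_fun_def by (intro less_LiminfD) (auto intro: less_le_trans)
    \<comment> \<open>\<open>lsc_fun\<close> speaks of punctured neighbourhoods; r <
      \<open>g l\<close> adds the centre, which the sequence may hit.\<close>
    then have "\<forall>\<^sub>F y in nhds l. ereal r < g y"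
      using r by (simp add: eventually_nhds_conv_at)
    with lim have "\<forall>\<^sub>F n in sequentially. ereal r < g (X n)"
      unfolding filterlim_iff by blast
    with le have ev: "\<forall>\<^sub>F n in sequentially. f (X n) + r \<le> c"
    proof eventually_elim
      case (elim n)
      then show ?case by (cases "g (X n)") auto
    qed
    have "(\<lambda>n. f (X n) + r) \<longlonglongrightarrow> f l + r"
      by (intro tendsto_add isCont_tendsto_compose[OF cont lim] tendsto_const)
    from tendsto_upperbound[OF this ev] show ?thesis by simp
  qed
  have "g l \<le> ereal (c - f l)"
  proof (rule ccontr)
    assume "\<not> g l \<le> ereal (c - f l)"
    then have "ereal (c - f l) < g l" by simp
    from ereal_dense2[OF this] obtain r where "ereal (c - f l) < ereal r" "ereal r < g l"
      by blast
    with *[of r] show False by simp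
  qed
  then show ?thesis by (cases "g l") auto
qed

text \<open>Later iterates replace a fixed point: each step shrinks the distance to all of them at
  once, so the distance from \<open>X k\<close> to its tail decays like q^k.\<close>

lemma contraction_towards_tail:
  fixes X :: "nat \<Rightarrow> 'a::banach"
  assumes q: "0 \<le> q" "q < 1"
    and contr: "\<And>k j. k < j \<Longrightarrow> norm (X (Suc k) - X j) \<le> q * norm (X k - X j)"
  shows "convergent X"
proof -
  \<comment> \<open>For j > 0, the triangle inequality through \<open>X 1\<close> bounds d =
    \<open>norm (X 0 - X j)\<close> by \<open>norm (X 1 - X 0)\<close> + q d; solving for d gives
    \<open>C\<close>.\<close>
  define C where "C = norm (X 1 - X 0) / (1 - q)"
  have C: "norm (X 0 - X j) \<le> C" for j
  proof (cases "j = 0")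
    case False
    have "norm (X 0 - X j) \<le> norm (X 0 - X 1) + norm (X 1 - X j)"
      by (metis diff_add_cancel add_diff_eq norm_triangle_ineq)
    with contr[of 0 j] False have "(1 - q) * norm (X 0 - X j) \<le> norm (X 1 - X 0)"
      by (simp add: algebra_simps norm_minus_commute)
    then show ?thesis using q by (simp add: C_def field_simps)
  qed (use q in \<open>simp add: C_def\<close>)
  have tail: "norm (X k - X j) \<le> q ^ k * C" if "k \<le> j" for k j
    using that
  proof (induction k)
    case (Suc k)
    then have "norm (X (Suc k) - X j) \<le> q * norm (X k - X j)" by (intro contr) simp
    also have "\<dots> \<le> q * (q ^ k * C)" using Suc q by (intro mult_left_mono) auto
    finally show ?case by simp
  qed (use C in simp)
  have "(\<lambda>k. q ^ k * C) \<longlonglongrightarrow> 0 * C"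
    using q by (intro tendsto_mult LIMSEQ_realpow_zero tendsto_const) auto
  then have lim: "(\<lambda>k. q ^ k * C) \<longlonglongrightarrow> 0" by simp
  have "Cauchy X"
    unfolding Cauchy_altdef
  proof (intro allI impI)
    fix e :: real assume "0 < e"
    with order_tendstoD(2)[OF lim] obtain N where N: "\<And>k. k \<ge> N \<Longrightarrow> q ^ k * C < e"
      by (auto simp: eventually_sequentially)
    show "\<exists>M. \<forall>m\<ge>M. \<forall>n>m. dist (X m) (X n) < e"
      unfolding dist_norm using le_less_trans[OF tail N] by (metis less_imp_le)
  qed
  then show ?thesis by (simp add: Cauchy_convergent_iff)
qed

theorem corollary4p3:
  fixes f :: "'m::finite \<Rightarrow> real^'n \<Rightarrow> real"
    and g :: "'m \<Rightarrow> real^'n \<Rightarrow> ereal"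
    and L \<mu> :: "'m \<Rightarrow> real"
    and x :: "nat \<Rightarrow> real^'n"
  assumes f_C1: "\<And>i. continuously_differentiable (f i)"
    and f_smooth: "\<And>i. L_smooth (L i) (f i)"
    and g_proper: "\<And>i. proper_fun (g i)"
    and g_convex: "\<And>i. convex_fun (g i)"
    and g_lsc: "\<And>i. lsc_fun (g i)"
    and mu_pos: "\<And>i. \<mu> i > 0"
    and f_strong: "\<And>i. strongly_convex (\<mu> i) (f i)"
    and x0_dom: "\<And>i. g i (x 0) \<noteq> \<infinity>"
    and x_step: "\<And>k. is_arg_min (subproblem_obj f g L (x k)) (\<lambda>z. True) (x (Suc k))"
    and no_stop: "\<And>k. x (Suc k) \<noteq> x k"
    and not_critical: "\<And>k. \<not> pareto_critical (composite f g) (x k)"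
  shows "\<exists>xs. pareto_solution (composite f g) xs \<and> x \<longlonglongrightarrow> xs \<and>
           (\<forall>k. norm (x (Suc k) - xs) \<le> sqrt (1 - (MIN i. \<mu> i / L i)) * norm (x k - xs))"
proof -

  \<comment> \<open>Reduction to real-valued functions on the common effective domain\<close>
  define D where "D = {z. \<forall>i. g i z \<noteq> \<infinity>}"
  \<comment> \<open>\<open>real_of_ereal\<close> sends infinity to 0, so all \<open>G i\<close>
    agree with \<open>g i\<close> only on \<open>D\<close>.\<close>
  define G where "G i z = real_of_ereal (g i z)" for i z
  define \<phi> where "\<phi> a z = (MAX i. (grad (f i) a \<bullet> (z - a) + G i z - G i a) / L i
    + 1/2 * (norm (z - a))\<^sup>2)" for a z
  define q where "q = sqrt (1 - (MIN i. \<mu> i / L i))"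
  have L_pos: "0 < L i" for i
    using strongly_convex_le_L_smooth[OF f_smooth f_strong, of i] mu_pos[of i] by simp
  have q: "0 \<le> q" "q < 1"
  proof -
    \<comment> \<open>The minimum is attained, so it is a single ratio in (0,1].\<close>
    have "(MIN i. \<mu> i / L i) \<in> range (\<lambda>i. \<mu> i / L i)" by (intro Min_in) auto
    then obtain i where "(MIN i. \<mu> i / L i) = \<mu> i / L i" by (rule rangeE)
    with L_pos[of i] mu_pos[of i] strongly_convex_le_L_smooth[OF f_smooth f_strong, of i]
    show "0 \<le> q" "q < 1" by (auto simp: q_def)
  qed
  have gG: "g i z = ereal (G i z)" if "z \<in> D" for i z
    using that g_proper[of i] by (cases "g i z") (auto simp: D_def G_def proper_fun_def)
  have convG: "convex_on D (G i)" for i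
  proof -
    have *: "g i (u *\<^sub>R a + v *\<^sub>R b) \<le> ereal (u * G i a + v * G i b)"
      if "a \<in> D" "b \<in> D" "0 \<le> u" "0 \<le> v" "u + v = 1" for i a b u v
      using that by (intro convex_fun_le g_convex) (auto simp: gG)
    have convD: "convex D"
    proof (rule convexI)
      fix a b and u v :: real
      assume "a \<in> D" "b \<in> D" "0 \<le> u" "0 \<le> v" "u + v = 1"
      then have "g i (u *\<^sub>R a + v *\<^sub>R b) \<noteq> \<infinity>" for i
        using *[of a b u v i] by auto
      then show "u *\<^sub>R a + v *\<^sub>R b \<in> D" by (simp add: D_def)
    qed
    show ?thesis unfolding convex_on_def
    proof (intro conjI convD ballI allI impI)
      fix a b and u v :: real
      assume "a \<in> D" "b \<in> D" "0 \<le> u" "0 \<le> v" "u + v = 1"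
      then show "G i (u *\<^sub>R a + v *\<^sub>R b) \<le> u * G i a + v * G i b"
        using *[of a b u v i] gG[OF convexD[OF convD], of a b u v i] by simp
    qed
  qed
  \<comment> \<open>One infinite \<open>g i z\<close> makes the whole maximum infinite, so
    minimising over the space amounts to minimising \<phi> over \<open>D\<close>.\<close>
  have sub: "subproblem_obj f g L a z = (if z \<in> D then ereal (\<phi> a z) else \<infinity>)" if "a \<in> D" for a z
  proof (cases "z \<in> D")
    case True
    have "subproblem_obj f g L a z = (MAX i. ereal ((grad (f i) a \<bullet> (z - a) + G i z - G i a) / L i
        + 1/2 * (norm (z - a))\<^sup>2))"
      unfolding subproblem_obj_def using L_pos
      by (simp add: gG[OF True] gG[OF that] less_imp_neq[symmetric])
    also have "\<dots> = ereal (\<phi> a z)"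
      unfolding \<phi>_def by (subst mono_Max_commute[of ereal]) (auto simp: mono_def image_image)
    finally show ?thesis using True by simp
  next
    case False
    then obtain i where i: "g i z = \<infinity>" by (auto simp: D_def)
    have "\<infinity> = (ereal (grad (f i) a \<bullet> (z - a)) + g i z - g i a) / ereal (L i)
        + ereal (1/2 * (norm (z - a))\<^sup>2)"
      using L_pos[of i] by (simp add: i gG[OF that])
    also have "\<dots> \<le> subproblem_obj f g L a z"
      unfolding subproblem_obj_def by (intro Max_ge) auto
    finally show ?thesis using False by simp
  qed
  have xD: "x k \<in> D" for k
  proof (induction k)
    case 0
    then show ?case using x0_dom by (simp add: D_def)
  next
    case (Suc k)
    \<comment> \<open>The competitor \<open>x k\<close> has a finite value, so the minimiser cannot
      leave \<open>D\<close>.\<close>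
    have "\<not> subproblem_obj f g L (x k) (x k) < subproblem_obj f g L (x k) (x (Suc k))"
      using x_step[of k] by (simp add: is_arg_min_def)
    then show ?case using Suc by (auto simp: sub split: if_splits)
  qed
  have min: "\<phi> (x k) (x (Suc k)) \<le> \<phi> (x k) y" if "y \<in> D" for k y
  proof -
    have "\<not> subproblem_obj f g L (x k) y < subproblem_obj f g L (x k) (x (Suc k))"
      using x_step[of k] by (simp add: is_arg_min_def)
    then show ?thesis using that by (simp add: sub xD)
  qed
  define F where "F i z = f i z + G i z" for i z
  have decr: "F i (x j) \<le> F i (x k)" if "k \<le> j" for i j k
  proof -
    have "F i (x (Suc k)) \<le> F i (x k)" for k
      unfolding F_def
      by (rule prox_step_descent[OF f_smooth L_pos min[OF xD, unfolded \<phi>_def]])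
    then show ?thesis using that by (rule lift_Suc_antimono_le[of "\<lambda>k. F i (x k)"])
  qed
  have contr: "norm (x (Suc k) - z) \<le> q * norm (x k - z)"
    if "z \<in> D" "\<And>i. F i z \<le> F i (x (Suc k))" for k z
    unfolding q_def
    by (rule prox_step_contraction[OF f_smooth f_strong L_pos convG xD
        min[unfolded \<phi>_def] that(1) that(2)[unfolded F_def]])

  \<comment> \<open>Convergence of the iterates and Pareto optimality of the limit\<close>
  have "convergent x"
    using decr by (intro contraction_towards_tail[OF q] contr xD) auto
  then obtain xs where xs: "x \<longlonglongrightarrow> xs" by (auto simp: convergent_def)
  have comp: "composite f g z i = ereal (F i z)" if "z \<in> D" for z i
    by (simp add: composite_def F_def gG[OF that])
  \<comment> \<open>For fixed k, all iterates from index k on lie in the closed sublevel set at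
    level \<open>F i (x k)\<close>.\<close>
  have xs_le: "composite f g xs i \<le> ereal (F i (x k))" for i k
    unfolding composite_def
  proof (rule lsc_fun_add_le[OF g_lsc _ xs])
    show "isCont (f i) xs"
      using f_smooth by (auto simp: L_smooth_def intro: differentiable_imp_continuous_within)
    show "\<forall>\<^sub>F n in sequentially. ereal (f i (x n)) + g i (x n) \<le> ereal (F i (x k))"
      using eventually_ge_at_top[of k] by eventually_elim (use decr in \<open>simp add: gG[OF xD] F_def\<close>)
  qed
  have DI: "z \<in> D" if "\<And>i. composite f g z i \<le> ereal (c i)" for z c
  proof -
    have "g i z \<noteq> \<infinity>" for i using that[of i] by (auto simp: composite_def)
    then show ?thesis by (simp add: D_def)
  qed
  have xsD: "xs \<in> D"
    using xs_le by (rule DI)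
  have "pareto_solution (composite f g) xs"
    unfolding pareto_solution_def
  proof (intro conjI allI notI)
    fix i assume "\<bar>composite f g xs i\<bar> = \<infinity>"
    then show False by (simp add: comp[OF xsD])
  next
    assume "\<exists>y. composite f g y \<le> composite f g xs \<and> composite f g y \<noteq> composite f g xs"
    then obtain y where y: "composite f g y \<le> composite f g xs"
      "composite f g y \<noteq> composite f g xs" by blast
    have y_le: "composite f g y i \<le> ereal (F i (x k))" for i k
      using y(1) xs_le by (meson le_funD order_trans)
    have yD: "y \<in> D"
      using y_le by (rule DI)
    have "norm (x (Suc k) - y) \<le> q * norm (x k - y)" for k
      using y_le by (intro contr yD) (auto simp: comp[OF yD])
    moreover have "(\<lambda>k. norm (x (Suc k) - y)) \<longlonglongrightarrow> norm (xs - y)"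
      using xs by (intro tendsto_intros LIMSEQ_Suc)
    moreover have "(\<lambda>k. q * norm (x k - y)) \<longlonglongrightarrow> q * norm (xs - y)"
      using xs by (intro tendsto_intros)
    \<comment> \<open>In the limit both distances become \<open>norm (xs - y)\<close>, and q < 1
      forces it to be 0.\<close>
    ultimately have "norm (xs - y) \<le> q * norm (xs - y)"
      by (intro LIMSEQ_le) auto
    then have "(1 - q) * norm (xs - y) \<le> 0" by (simp add: algebra_simps)
    then have "y = xs" using q by (simp add: mult_le_0_iff)
    with y(2) show False by simp
  qed
  moreover have "norm (x (Suc k) - xs) \<le> q * norm (x k - xs)" for k
    using xs_le by (intro contr xsD) (auto simp: comp[OF xsD])
  ultimately show ?thesis using xs unfolding q_def by blast
qed

end
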